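(* Let $P_n$ be the path graph on $n \geq 3$ vertices. Then the automorphism group of its $3$-token graph satisfies $$\operatorname{Aut}(\Gamma_3(P_n)) \cong \begin{cases} \mathbb{Z}_1, & n = 3,\\ \mathbb{Z}_2 \times \mathbb{Z}_2, & n = 6,\\ \mathbb{Z}_2, & \text{otherwise}.\end{cases}$$
   Context: All graphs are finite, simple and undirected. $P_n$ is the path with vertices $x_1,\dots,x_n$ and edges $x_ix_{i+1}$. The $3$-token graph $\Gamma_3(G)$ has as vertices the $3$-element subsets of $V(G)$, two distinct subsets $A,B$ being adjacent iff $A\triangle B=\{x,y\}$ with $xy\in E(G)$. $\operatorname{Aut}(G)$ is the group of graph automorphisms of $G$; $\mathbb{Z}_m$ is the cyclic group of order $m$. *)

theory Defs
  imports
    "HOL-Algebra.Bij"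
    "HOL-Algebra.Elementary_Groups"
    "Graph_Theory.Pair_Digraph"
begin

(* Finite simple undirected graphs are those satisfying the locale pair_graph: an edge xy is
   represented by the two arcs (x, y) and (y, x). *)

definition path_graph :: "nat \<Rightarrow> nat pair_pre_digraph" where
  "path_graph n =
     \<lparr>pverts = {1..n},
      parcs = {(i, j). i \<in> {1..n} \<and> j \<in> {1..n} \<and> (j = i + 1 \<or> i = j + 1)}\<rparr>"

definition token_graph :: "nat \<Rightarrow> 'a pair_pre_digraph \<Rightarrow> 'a set pair_pre_digraph" where
  "token_graph k G =
     (let V = {A. A \<subseteq> pverts G \<and> finite A \<and> card A = k} in
      \<lparr>pverts = V,
       parcs = {(A, B). A \<in> V \<and> B \<in> V \<and> A \<noteq> B \<and>
                  (\<exists>x y. sym_diff A B = {x, y} \<and> (x, y) \<in> parcs G)}\<rparr>)"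

definition graph_automorphisms :: "'a pair_pre_digraph \<Rightarrow> ('a \<Rightarrow> 'a) set" where
  "graph_automorphisms G =
     {f \<in> Bij (pverts G). \<forall>u\<in>pverts G. \<forall>v\<in>pverts G.
        (u, v) \<in> parcs G \<longleftrightarrow> (f u, f v) \<in> parcs G}"

definition graph_aut_group :: "'a pair_pre_digraph \<Rightarrow> ('a \<Rightarrow> 'a) monoid" where
  "graph_aut_group G = (BijGroup (pverts G))\<lparr>carrier := graph_automorphisms G\<rparr>"

lemma pair_graph_path_graph: "pair_graph (path_graph n)"
proof unfold_locales
  show "finite (parcs (path_graph n))"
    by (rule finite_subset[of _ "{1..n} \<times> {1..n}"]) (auto simp: path_graph_def)
qed (auto simp: path_graph_def symmetric_def intro!: symI)

lemma pair_graph_token_graph: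
  assumes "pair_graph G"
  shows "pair_graph (token_graph k G)"
proof -
  interpret pair_graph G by fact
  let ?V = "pverts (token_graph k G)"
  have fin: "finite ?V"
    by (rule finite_subset[of _ "Pow (pverts G)"]) (auto simp: token_graph_def Let_def)
  have arc_iff: "(A, B) \<in> parcs (token_graph k G) \<longleftrightarrow>
      A \<in> ?V \<and> B \<in> ?V \<and> A \<noteq> B \<and> (\<exists>x y. sym_diff A B = {x, y} \<and> (x, y) \<in> parcs G)"
    for A B by (simp add: token_graph_def Let_def)
  have sub: "parcs (token_graph k G) \<subseteq> ?V \<times> ?V"
    by (rule subrelI) (simp add: arc_iff)
  show ?thesis
  proof unfold_locales
    show "finite (parcs (token_graph k G))"
      using sub fin by (meson finite_SigmaI finite_subset)
    have "(B, A) \<in> parcs (token_graph k G)" if "(A, B) \<in> parcs (token_graph k G)" for A B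
      using that unfolding arc_iff by (metis Un_commute)
    then show "symmetric (with_proj (token_graph k G))"
      unfolding symmetric_def with_proj_simps by (rule symI)
  next
    fix e assume e: "e \<in> parcs (token_graph k G)"
    show "fst e \<in> ?V" "snd e \<in> ?V" using sub e by auto
    show "fst e \<noteq> snd e" using e arc_iff[of "fst e" "snd e"] by simp
  qed (rule fin)
qed

lemma subgroup_graph_automorphisms:
  "subgroup (graph_automorphisms G) (BijGroup (pverts G))"
proof -
  let ?V = "pverts G"
  interpret group "BijGroup ?V" by (rule group_BijGroup)
  show ?thesis
  proof (rule subgroupI)
    show "graph_automorphisms G \<subseteq> carrier (BijGroup ?V)"
      by (auto simp: graph_automorphisms_def BijGroup_def)
    have "(\<lambda>x\<in>?V. x) \<in> graph_automorphisms G"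
      by (auto simp: graph_automorphisms_def id_Bij)
    then show "graph_automorphisms G \<noteq> {}" by blast
  next
    fix f assume f: "f \<in> graph_automorphisms G"
    then have fB: "f \<in> Bij ?V" by (simp add: graph_automorphisms_def)
    let ?g = "\<lambda>x\<in>?V. inv_into ?V f x"
    have bij: "bij_betw f ?V ?V" using fB by (simp add: Bij_def)
    have "(u, v) \<in> parcs G \<longleftrightarrow> (?g u, ?g v) \<in> parcs G" if "u \<in> ?V" "v \<in> ?V" for u v
    proof -
      have "inv_into ?V f u \<in> ?V" "inv_into ?V f v \<in> ?V"
        using that Bij_inv_into_mem[OF fB] by auto
      moreover have "f (inv_into ?V f u) = u" "f (inv_into ?V f v) = v"
        using that bij by (auto simp: bij_betw_inv_into_right)
      moreover have "\<forall>u\<in>?V. \<forall>v\<in>?V. (u, v) \<in> parcs G \<longleftrightarrow> (f u, f v) \<in> parcs G"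
        using f by (simp add: graph_automorphisms_def)
      ultimately show ?thesis using that by (metis restrict_apply')
    qed
    then have "?g \<in> graph_automorphisms G"
      using restrict_inv_into_Bij[OF fB] by (simp add: graph_automorphisms_def)
    then show "inv\<^bsub>BijGroup ?V\<^esub> f \<in> graph_automorphisms G"
      using inv_BijGroup[OF fB] by simp
  next
    fix f g assume fg: "f \<in> graph_automorphisms G" "g \<in> graph_automorphisms G"
    then have B: "f \<in> Bij ?V" "g \<in> Bij ?V" by (auto simp: graph_automorphisms_def)
    have "g u \<in> ?V" if "u \<in> ?V" for u using Bij_imp_funcset[OF B(2)] that by auto
    then have "compose ?V f g \<in> graph_automorphisms G"
      using fg compose_Bij[OF B] by (auto simp: graph_automorphisms_def compose_eq)
    then show "f \<otimes>\<^bsub>BijGroup ?V\<^esub> g \<in> graph_automorphisms G"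
      using B by (simp add: BijGroup_def)
  qed
qed

lemma group_graph_aut_group: "group (graph_aut_group G)"
  unfolding graph_aut_group_def
  by (rule subgroup.subgroup_is_group[OF subgroup_graph_automorphisms group_BijGroup])

end

theory Submission
  imports Defs
begin

text \<open>Order the tokens as \<open>a < b < c\<close>; each edge moves one of them by one step. The only vertices
  of degree one are \<open>{1, 2, 3}\<close> and \<open>{n - 2, n - 1, n}\<close>, so up to the reflection of the path an
  automorphism \<open>f\<close> fixes \<open>{1, 2, 3}\<close>. By induction on \<open>a + b + c\<close>, the image of every vertex is then
  determined by those of lower vertices, except that \<open>{1, 2, 5}\<close> and \<open>{1, 3, 4}\<close>, the two upper
  neighbours of \<open>{1, 2, 4}\<close>, might be swapped. Comparing degrees nearby rules out the swap unless
  \<open>n = 6\<close>, where it is realised by complementation followed by the reflection.\<close>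

section \<open>Groups of exponent two\<close>

text \<open>Cancellation excludes \<open>r \<otimes> r = r\<close>, so \<open>r\<close> is an
  involution and the whole multiplication table is forced.\<close>

lemma (in group) iso_integer_mod_group_2:
  assumes "carrier G = {\<one>, r}" "r \<noteq> \<one>"
  shows "G \<cong> integer_mod_group 2"
proof -
  have r: "r \<in> carrier G" using assms(1) by simp
  then have "r \<otimes> r \<noteq> r" using assms(2) l_cancel_one by blast
  moreover have "r \<otimes> r \<in> {\<one>, r}" using r assms(1) m_closed by blast
  ultimately have rr: "r \<otimes> r = \<one>" by blast
  let ?h = "\<lambda>x. if x = \<one> then 0 else 1 :: int"
  have "?h \<in> iso G (integer_mod_group 2)"
    using assms r rr
    by (auto simp: iso_def hom_def carrier_integer_mod_group bij_betw_def inj_on_def image_iff)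
  then show ?thesis unfolding is_iso_def by blast
qed

text \<open>Both generators are their own inverses, so the four listed elements are distinct.
  Commutativity follows by elimination: \<open>k \<otimes> r\<close> cannot be
  \<open>\<one>\<close>, \<open>r\<close> or \<open>k\<close>, which leaves only
  \<open>r \<otimes> k\<close>.\<close>

lemma (in group) iso_integer_mod_group_2_DirProd:
  assumes "carrier G = {\<one>, r, k, r \<otimes> k}"
    and r: "r \<otimes> r = \<one>" "r \<noteq> \<one>" and k: "k \<otimes> k = \<one>" "k \<noteq> \<one>" and "r \<noteq> k"
  shows "G \<cong> integer_mod_group 2 \<times>\<times> integer_mod_group 2"
proof -
  have car: "r \<in> carrier G" "k \<in> carrier G" using assms(1) by blast+
  have inv: "inv r = r" "inv k = k" using inv_equality[OF r(1)] inv_equality[OF k(1)] car by simp_all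
  have ne: "r \<otimes> k \<noteq> \<one>" "r \<otimes> k \<noteq> r" "r \<otimes> k \<noteq> k"
    using inv_equality[of r k] car r(2) k(2) \<open>r \<noteq> k\<close> inv by auto
  have "k \<otimes> r \<in> {\<one>, r, k, r \<otimes> k}" using car assms(1) m_closed by blast
  moreover have "k \<otimes> r \<noteq> \<one>" using inv_equality[of k r] car inv \<open>r \<noteq> k\<close> by auto
  moreover have "k \<otimes> r \<noteq> r" "k \<otimes> r \<noteq> k" using car r(2) k(2) by auto
  ultimately have comm: "k \<otimes> r = r \<otimes> k" by blast
  have m: "r \<otimes> (r \<otimes> k) = k" "k \<otimes> (r \<otimes> k) = r" "r \<otimes> k \<otimes> r = k" "r \<otimes> k \<otimes> k = r"
    "r \<otimes> k \<otimes> (r \<otimes> k) = \<one>"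
    using m_assoc[of r r k] m_assoc[of k k r] m_assoc[of r k r] m_assoc[of r k k]
      m_assoc[of r k "r \<otimes> k"] m_assoc[of k r k] car r(1) k(1) comm by simp_all
  \<comment> \<open>The two coordinates are the exponents of \<open>r\<close> and of
    \<open>k\<close>.\<close>
  define h :: "'a \<Rightarrow> int \<times> int" where
    "h x = (if x = \<one> \<or> x = k then 0 else 1, if x = \<one> \<or> x = r then 0 else 1)" for x
  have h: "h \<one> = (0, 0)" "h r = (1, 0)" "h k = (0, 1)" "h (r \<otimes> k) = (1, 1)"
    unfolding h_def using r(2) k(2) ne \<open>r \<noteq> k\<close> \<open>r \<noteq> k\<close>[symmetric]
    by (simp_all only: simp_thms if_True if_False)
  have "h \<in> iso G (integer_mod_group 2 \<times>\<times> integer_mod_group 2)"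
    unfolding iso_def
  proof (intro CollectI conjI)
    show "h \<in> hom G (integer_mod_group 2 \<times>\<times> integer_mod_group 2)"
    proof (rule homI)
      fix x y assume "x \<in> carrier G" "y \<in> carrier G"
      then have "x \<in> {\<one>, r, k, r \<otimes> k}" "y \<in> {\<one>, r, k, r \<otimes> k}" using assms(1) by blast+
      then show "h (x \<otimes> y) = h x \<otimes>\<^bsub>integer_mod_group 2 \<times>\<times> integer_mod_group 2\<^esub> h y"
        by (elim insertE emptyE; hypsubst) (simp_all add: h r(1) k(1) comm m car)
    qed (simp add: h_def carrier_integer_mod_group)
    have "{0..<2} = {0, 1::int}" by auto
    then show "bij_betw h (carrier G) (carrier (integer_mod_group 2 \<times>\<times> integer_mod_group 2))"
      unfolding assms(1) by (simp add: bij_betw_def inj_on_def h carrier_integer_mod_group) blast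
  qed
  then show ?thesis unfolding is_iso_def by blast
qed

section \<open>Graph automorphisms\<close>

lemma
  assumes "f \<in> graph_automorphisms G"
  shows graph_automorphism_closed: "u \<in> pverts G \<Longrightarrow> f u \<in> pverts G"
    and graph_automorphism_inj: "u \<in> pverts G \<Longrightarrow> v \<in> pverts G \<Longrightarrow> f u = f v \<longleftrightarrow> u = v"
    and graph_automorphism_surj: "v \<in> pverts G \<Longrightarrow> \<exists>u\<in>pverts G. f u = v"
    and graph_automorphism_arc:
      "u \<in> pverts G \<Longrightarrow> v \<in> pverts G \<Longrightarrow> (f u, f v) \<in> parcs G \<longleftrightarrow> (u, v) \<in> parcs G"
proof -
  have bij: "bij_betw f (pverts G) (pverts G)"
    using assms by (simp add: graph_automorphisms_def Bij_def)
  show "u \<in> pverts G \<Longrightarrow> f u \<in> pverts G" using bij by (rule bij_betw_apply)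
  show "u \<in> pverts G \<Longrightarrow> v \<in> pverts G \<Longrightarrow> f u = f v \<longleftrightarrow> u = v"
    using bij by (auto simp: bij_betw_def inj_on_eq_iff)
  show "v \<in> pverts G \<Longrightarrow> \<exists>u\<in>pverts G. f u = v"
    using bij_betw_imp_surj_on[OF bij] by (metis imageE)
  show "u \<in> pverts G \<Longrightarrow> v \<in> pverts G \<Longrightarrow> (f u, f v) \<in> parcs G \<longleftrightarrow> (u, v) \<in> parcs G"
    using assms by (simp add: graph_automorphisms_def)
qed

text \<open>Since \<open>S\<close> is fixed pointwise, \<open>f u\<close> is again a common
  neighbour of \<open>S\<close>. It is therefore \<open>u\<close> itself or a fixed vertex, and in
  the latter case injectivity turns \<open>f (f u) = f u\<close> into
  \<open>f u = u\<close>.\<close>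

lemma graph_automorphism_fixes:
  assumes f: "f \<in> graph_automorphisms G" and u: "u \<in> pverts G"
    and S: "S \<subseteq> pverts G" "\<And>w. w \<in> S \<Longrightarrow> f w = w" "\<And>w. w \<in> S \<Longrightarrow> (u, w) \<in> parcs G"
    and others: "\<And>v. v \<in> pverts G \<Longrightarrow> \<forall>w\<in>S. (v, w) \<in> parcs G \<Longrightarrow> v = u \<or> f v = v"
  shows "f u = u"
proof -
  have fu: "f u \<in> pverts G" using f u by (rule graph_automorphism_closed)
  have "(f u, w) \<in> parcs G" if "w \<in> S" for w
    using graph_automorphism_arc[OF f u, of w] S that by auto
  then have "f u = u \<or> f (f u) = f u" using others fu by blast
  then show ?thesis using graph_automorphism_inj[OF f fu u] by blast
qed

text \<open>An involution needs arc preservation in one direction only; the converse is the same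
  fact applied to \<open>h u\<close> and \<open>h v\<close>.\<close>

lemma graph_automorphism_involution:
  assumes closed: "\<And>u. u \<in> pverts G \<Longrightarrow> h u \<in> pverts G"
    and invol: "\<And>u. u \<in> pverts G \<Longrightarrow> h (h u) = u"
    and arc: "\<And>u v. (u, v) \<in> parcs G \<Longrightarrow> u \<in> pverts G \<Longrightarrow> v \<in> pverts G \<Longrightarrow> (h u, h v) \<in> parcs G"
  shows "restrict h (pverts G) \<in> graph_automorphisms G"
proof -
  have "bij_betw h (pverts G) (pverts G)"
    by (rule bij_betw_byWitness[of _ h]) (use closed invol in auto)
  moreover have "(h u, h v) \<in> parcs G \<Longrightarrow> (u, v) \<in> parcs G"
    if "u \<in> pverts G" "v \<in> pverts G" for u v
    using arc[of "h u" "h v"] closed invol that by simp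
  ultimately show ?thesis
    using arc by (auto simp: graph_automorphisms_def Bij_def)
qed

lemma carrier_graph_aut_group: "carrier (graph_aut_group G) = graph_automorphisms G"
  and one_graph_aut_group: "\<one>\<^bsub>graph_aut_group G\<^esub> = (\<lambda>u\<in>pverts G. u)"
  by (simp_all add: graph_aut_group_def BijGroup_def)

lemma mult_graph_aut_group:
  assumes "f \<in> graph_automorphisms G" "g \<in> graph_automorphisms G"
  shows "f \<otimes>\<^bsub>graph_aut_group G\<^esub> g = compose (pverts G) f g"
  using assms by (simp add: graph_aut_group_def BijGroup_def graph_automorphisms_def)

lemma graph_automorphism_eqI:
  assumes "f \<in> graph_automorphisms G" "g \<in> graph_automorphisms G"
    and "\<And>u. u \<in> pverts G \<Longrightarrow> f u = g u"
  shows "f = g"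
  using assms by (auto simp: graph_automorphisms_def Bij_def intro: extensionalityI)

section \<open>The token graph in coordinates\<close>

abbreviation path_tokens :: "nat \<Rightarrow> nat set pair_pre_digraph" where
  "path_tokens n \<equiv> token_graph 3 (path_graph n)"

text \<open>Sorting the tokens gives each vertex exactly one coordinate triple, so that adjacency
  becomes linear arithmetic.\<close>

definition config :: "nat \<Rightarrow> nat \<Rightarrow> nat \<Rightarrow> nat \<Rightarrow> bool" where
  "config n a b c \<longleftrightarrow> 1 \<le> a \<and> a < b \<and> b < c \<and> c \<le> n"

definition near :: "nat \<Rightarrow> nat \<Rightarrow> bool" where
  "near x y \<longleftrightarrow> y = x + 1 \<or> x = y + 1"

text \<open>Tokens keep their order when one of them steps to a free position, so an edge changes a
  single sorted coordinate by one.\<close>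

definition token_move :: "nat \<Rightarrow> nat \<Rightarrow> nat \<Rightarrow> nat \<Rightarrow> nat \<Rightarrow> nat \<Rightarrow> bool" where
  "token_move a b c x y z \<longleftrightarrow>
     near a x \<and> b = y \<and> c = z \<or> a = x \<and> near b y \<and> c = z \<or> a = x \<and> b = y \<and> near c z"

lemma path_tokens_verts_iff:
  "A \<in> pverts (path_tokens n) \<longleftrightarrow> (\<exists>a b c. config n a b c \<and> A = {a, b, c})"
proof
  assume "A \<in> pverts (path_tokens n)"
  then have A: "A \<subseteq> {1..n}" "card A = 3"
    by (auto simp: token_graph_def path_graph_def Let_def)
  from A(2) obtain x y z where xyz: "A = {x, y, z}" "x \<noteq> y" "y \<noteq> z" "x \<noteq> z"
    by (auto simp: card_3_iff)
  have bounds: "1 \<le> x" "x \<le> n" "1 \<le> y" "y \<le> n" "1 \<le> z" "z \<le> n"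
    using A(1) xyz(1) by auto
  have sorted: "\<exists>a b c. config n a b c \<and> A = {a, b, c}"
    if "u < v" "v < w" "1 \<le> u" "w \<le> n" "A = {u, v, w}" for u v w
    using that unfolding config_def by blast
  have perms: "A = {x, z, y}" "A = {y, x, z}" "A = {y, z, x}" "A = {z, x, y}" "A = {z, y, x}"
    using xyz(1) by blast+
  consider "x < y" "y < z" | "x < z" "z < y" | "y < x" "x < z"
    | "y < z" "z < x" | "z < x" "x < y" | "z < y" "y < x"
    using xyz by linarith
  then show "\<exists>a b c. config n a b c \<and> A = {a, b, c}"
  proof cases
    case 1
    then show ?thesis by (rule sorted[OF _ _ bounds(1,6) xyz(1)])
  next
    case 2
    then show ?thesis by (rule sorted[OF _ _ bounds(1,4) perms(1)])
  next
    case 3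
    then show ?thesis by (rule sorted[OF _ _ bounds(3,6) perms(2)])
  next
    case 4
    then show ?thesis by (rule sorted[OF _ _ bounds(3,2) perms(3)])
  next
    case 5
    then show ?thesis by (rule sorted[OF _ _ bounds(5,4) perms(4)])
  next
    case 6
    then show ?thesis by (rule sorted[OF _ _ bounds(5,2) perms(5)])
  qed
next
  assume "\<exists>a b c. config n a b c \<and> A = {a, b, c}"
  then show "A \<in> pverts (path_tokens n)"
    by (auto simp: token_graph_def path_graph_def Let_def config_def)
qed

lemma path_tokens_vertsE:
  assumes "A \<in> pverts (path_tokens n)"
  obtains a b c where "config n a b c" "A = {a, b, c}"
  using assms unfolding path_tokens_verts_iff by (elim exE conjE)

lemma config_verts: "config n a b c \<Longrightarrow> {a, b, c} \<in> pverts (path_tokens n)"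
  using path_tokens_verts_iff by blast

text \<open>Minimum and maximum recover the outer coordinates, and the middle one is what
  remains.\<close>

lemma config_eq_iff:
  assumes "config n a b c" "config n x y z"
  shows "{a, b, c} = {x, y, z} \<longleftrightarrow> a = x \<and> b = y \<and> c = z"
proof
  assume eq: "{a, b, c} = {x, y, z}"
  have "Min {a, b, c} = a" "Max {a, b, c} = c" "Min {x, y, z} = x" "Max {x, y, z} = z"
    using assms by (auto simp: config_def min_def max_def)
  then have "a = x" "c = z" using eq by auto
  moreover have "b \<in> {x, y, z}" using eq by blast
  ultimately show "a = x \<and> b = y \<and> c = z" using assms by (auto simp: config_def)
qed simp

lemma path_tokens_arc_iff:
  "(A, B) \<in> parcs (path_tokens n) \<longleftrightarrow>
     A \<in> pverts (path_tokens n) \<and> B \<in> pverts (path_tokens n) \<and>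
     (\<exists>x y. sym_diff A B = {x, y} \<and> near x y \<and> x \<in> {1..n} \<and> y \<in> {1..n})"
  by (auto simp: token_graph_def path_graph_def Let_def near_def)

text \<open>Sets of equal finite size that differ cannot contain one another, so each of them
  contributes one of the two points.\<close>

lemma sym_diff_eq_pair:
  assumes "finite A" "finite B" "card A = card B" "sym_diff A B = {p, q}" "p \<noteq> q"
  shows "p \<in> A \<and> q \<notin> A \<and> B = insert q (A - {p}) \<or> q \<in> A \<and> p \<notin> A \<and> B = insert p (A - {q})"
proof -
  have "A \<noteq> B" using assms(4) by blast
  then have "\<not> A \<subseteq> B" "\<not> B \<subseteq> A"
    using assms(1-3) card_subset_eq by metis+
  moreover have mem: "x \<in> A \<longleftrightarrow> (x \<in> B \<longleftrightarrow> x \<noteq> p \<and> x \<noteq> q)" for x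
    using assms(4) by (auto simp: set_eq_iff)
  ultimately have "p \<in> A \<longleftrightarrow> q \<notin> A"
    using subsetI by metis
  then show ?thesis using mem assms(5) by (auto simp: set_eq_iff)
qed

text \<open>An arc replaces some \<open>p\<close> by an adjacent \<open>q\<close>. As
  \<open>q\<close> is unoccupied and only one step away, no token is passed, and putting
  \<open>q\<close> in the place of \<open>p\<close> leaves the triple sorted.\<close>

lemma token_move_iff:
  assumes A: "config n a b c" and B: "config n x y z"
  shows "({a, b, c}, {x, y, z}) \<in> parcs (path_tokens n) \<longleftrightarrow> token_move a b c x y z"
proof
  assume "token_move a b c x y z"
  moreover have "sym_diff {a, b, c} {x, b, c} = {a, x}" if "near a x" "b = y" "c = z"
    using that A B by (auto simp: near_def config_def)
  moreover have "sym_diff {a, b, c} {a, y, c} = {b, y}" if "near b y" "a = x" "c = z"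
    using that A B by (auto simp: near_def config_def)
  moreover have "sym_diff {a, b, c} {a, b, z} = {c, z}" if "near c z" "a = x" "b = y"
    using that A B by (auto simp: near_def config_def)
  moreover have "{a, b, c, x, y, z} \<subseteq> {1..n}" using A B by (auto simp: config_def)
  ultimately show "({a, b, c}, {x, y, z}) \<in> parcs (path_tokens n)"
    unfolding path_tokens_arc_iff token_move_def
    using config_verts[OF A] config_verts[OF B] by (elim disjE) auto
next
  let ?A = "{a, b, c}" and ?B = "{x, y, z}"
  assume "(?A, ?B) \<in> parcs (path_tokens n)"
  then obtain p q where pq: "sym_diff ?A ?B = {p, q}" "near p q" "p \<in> {1..n}" "q \<in> {1..n}"
    unfolding path_tokens_arc_iff by (elim conjE exE)
  have cards: "card ?A = 3" "card ?B = 3" using A B by (auto simp: config_def)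
  \<comment> \<open>The symmetric difference is an unordered pair, so this is stated for arbitrary
    \<open>p\<close> and \<open>q\<close> and used below for both orientations.\<close>
  have key: "token_move a b c x y z"
    if "p \<in> ?A" "?B = insert q (?A - {p})" "near p q" "q \<notin> ?A" "q \<in> {1..n}" for p q
  proof -
    have tm: "token_move a b c x y z" if "config n u v w" "token_move a b c u v w" "?B = {u, v, w}" for u v w
      using that config_eq_iff[OF B that(1)] by blast
    have q: "q \<noteq> a" "q \<noteq> b" "q \<noteq> c" "1 \<le> q" "q \<le> n" using that by auto
    consider "p = a" | "p = b" | "p = c" using \<open>p \<in> ?A\<close> by blast
    then show ?thesis
    proof cases
      case 1
      show ?thesis
      proof (rule tm)
        have "near a q" using 1 \<open>near p q\<close> by simp
        then show "config n q b c" using q A unfolding config_def near_def by linarith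
        show "token_move a b c q b c" using \<open>near a q\<close> by (simp add: token_move_def)
        have "?A - {a} = {b, c}" using A by (auto simp: config_def)
        then show "?B = {q, b, c}" unfolding that(2) 1 by (simp only: insert_commute)
      qed
    next
      case 2
      show ?thesis
      proof (rule tm)
        have "near b q" using 2 \<open>near p q\<close> by simp
        then show "config n a q c" using q A unfolding config_def near_def by linarith
        show "token_move a b c a q c" using \<open>near b q\<close> by (simp add: token_move_def)
        have "?A - {b} = {a, c}" using A by (auto simp: config_def)
        then show "?B = {a, q, c}" unfolding that(2) 2 by (simp only: insert_commute)
      qed
    next
      case 3
      show ?thesis
      proof (rule tm)
        have "near c q" using 3 \<open>near p q\<close> by simp
        then show "config n a b q" using q A unfolding config_def near_def by linarith
        show "token_move a b c a b q" using \<open>near c q\<close> by (simp add: token_move_def)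
        have "?A - {c} = {a, b}" using A by (auto simp: config_def)
        then show "?B = {a, b, q}" unfolding that(2) 3 by (simp only: insert_commute)
      qed
    qed
  qed
  have "p \<noteq> q" using pq(2) by (auto simp: near_def)
  then consider "p \<in> ?A" "q \<notin> ?A" "?B = insert q (?A - {p})"
    | "q \<in> ?A" "p \<notin> ?A" "?B = insert p (?A - {q})"
    using sym_diff_eq_pair[of ?A ?B p q] cards pq(1) by (metis finite.emptyI finite.insertI)
  then show "token_move a b c x y z"
  proof cases
    case 1
    show ?thesis by (rule key[OF 1(1,3) pq(2) 1(2) pq(4)])
  next
    case 2
    have "near q p" using pq(2) by (auto simp: near_def)
    then show ?thesis by (rule key[OF 2(1,3) _ 2(2) pq(3)])
  qed
qed

lemma path_tokens_nbrs:
  assumes "(v, {p, q, r}) \<in> parcs (path_tokens n)" "config n p q r"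
  obtains x y z where "config n x y z" "v = {x, y, z}" "token_move x y z p q r"
proof -
  have "v \<in> pverts (path_tokens n)" using assms(1) path_tokens_arc_iff by blast
  then obtain x y z where "config n x y z" "v = {x, y, z}" by (rule path_tokens_vertsE)
  then show thesis using that token_move_iff assms by simp
qed

lemmas move_simps = config_def token_move_def near_def

section \<open>Rigidity\<close>

locale path_tokens_aut =
  fixes n :: nat and f :: "nat set \<Rightarrow> nat set"
  assumes f: "f \<in> graph_automorphisms (path_tokens n)"
begin

section \<open>Transport of coordinates and moves along an automorphism\<close>

abbreviation fixed :: "nat \<Rightarrow> nat \<Rightarrow> nat \<Rightarrow> bool" where
  "fixed a b c \<equiv> f {a, b, c} = {a, b, c}"

lemma image_config:
  assumes "config n a b c"
  obtains x y z where "config n x y z" "f {a, b, c} = {x, y, z}"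
  using graph_automorphism_closed[OF f config_verts[OF assms]] that by (rule path_tokens_vertsE)

lemma image_eq_iff:
  assumes "config n a b c" "config n x y z"
  shows "f {a, b, c} = f {x, y, z} \<longleftrightarrow> a = x \<and> b = y \<and> c = z"
  using graph_automorphism_inj[OF f assms[THEN config_verts]] config_eq_iff[OF assms] by simp

lemma image_move:
  assumes "config n a b c" "config n p q r" "token_move a b c p q r"
    and "f {p, q, r} = {x, y, z}" "config n x y z"
  obtains u v w where "config n u v w" "f {a, b, c} = {u, v, w}" "token_move u v w x y z"
proof -
  have "(f {a, b, c}, {x, y, z}) \<in> parcs (path_tokens n)"
    using graph_automorphism_arc[OF f assms(1,2)[THEN config_verts]] token_move_iff assms by simp
  then show thesis using assms(5) that by (rule path_tokens_nbrs)
qed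

text \<open>By surjectivity a neighbour of an image has a preimage, and reflecting the arc places it
  next to \<open>{p, q, r}\<close>. Together with \<open>image_move\<close> this allows degrees to
  be compared.\<close>

lemma preimage_move:
  assumes "config n p q r" "f {p, q, r} = {x, y, z}" "config n x y z"
    and "config n u v w" "token_move u v w x y z"
  obtains a b c where "config n a b c" "f {a, b, c} = {u, v, w}" "token_move a b c p q r"
proof -
  obtain A where A: "A \<in> pverts (path_tokens n)" "f A = {u, v, w}"
    using graph_automorphism_surj[OF f config_verts[OF assms(4)]] by (elim bexE)
  have "(f A, f {p, q, r}) \<in> parcs (path_tokens n)"
    using A(2) assms token_move_iff by simp
  then have "(A, {p, q, r}) \<in> parcs (path_tokens n)"
    using graph_automorphism_arc[OF f A(1) config_verts[OF assms(1)]] by simp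
  then obtain a b c where "config n a b c" "A = {a, b, c}" "token_move a b c p q r"
    using assms(1) by (rule path_tokens_nbrs)
  then show thesis using that A(2) by simp
qed

section \<open>Propagation of fixed configurations\<close>

text \<open>This is \<open>graph_automorphism_fixes\<close> in coordinates, for a set
  \<open>S\<close> of two fixed neighbours.\<close>

lemma fixed_by_two:
  assumes "config n a b c" "config n p q r" "config n p' q' r'"
    and "token_move a b c p q r" "token_move a b c p' q' r'" "fixed p q r" "fixed p' q' r'"
    and others: "\<And>x y z. config n x y z \<Longrightarrow> token_move x y z p q r \<Longrightarrow> token_move x y z p' q' r' \<Longrightarrow>
      x = a \<and> y = b \<and> z = c \<or> fixed x y z"
  shows "fixed a b c"
proof (rule graph_automorphism_fixes[OF f])
  let ?S = "{{p, q, r}, {p', q', r'}}"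
  show "{a, b, c} \<in> pverts (path_tokens n)" "?S \<subseteq> pverts (path_tokens n)"
    using assms config_verts by auto
  show "f w = w" "({a, b, c}, w) \<in> parcs (path_tokens n)" if "w \<in> ?S" for w
    using that assms token_move_iff by auto
  fix v assume "v \<in> pverts (path_tokens n)" and v: "\<forall>w\<in>?S. (v, w) \<in> parcs (path_tokens n)"
  from this(1) obtain x y z where xyz: "config n x y z" "v = {x, y, z}" by (rule path_tokens_vertsE)
  then have "token_move x y z p q r" "token_move x y z p' q' r'"
    using v token_move_iff assms(2,3) by auto
  then show "v = {a, b, c} \<or> f v = v" using others xyz by blast
qed

text \<open>The special case in which the two fixed neighbours coincide.\<close>

lemma fixed_by_one:
  assumes "config n a b c" "config n p q r" "token_move a b c p q r" "fixed p q r"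
    and "\<And>x y z. config n x y z \<Longrightarrow> token_move x y z p q r \<Longrightarrow> x = a \<and> y = b \<and> z = c \<or> fixed x y z"
  shows "fixed a b c"
  using assms by (intro fixed_by_two[of a b c p q r p q r]) auto

text \<open>If two tokens can move down, the configuration is one of the only two common neighbours of
  the results; the other one arises by making both moves.\<close>

lemma fixed_step:
  assumes abc: "config n a b c"
    and two: "1 < a \<and> a + 1 < b \<or> 1 < a \<and> b + 1 < c \<or> a + 1 < b \<and> b + 1 < c"
    and IH: "\<And>x y z. config n x y z \<Longrightarrow> x + y + z < a + b + c \<Longrightarrow> fixed x y z"
  shows "fixed a b c"
proof -
  consider (ab) "1 < a" "a + 1 < b" | (ac) "1 < a" "b + 1 < c" | (bc) "a + 1 < b" "b + 1 < c"
    using two by blast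
  then show ?thesis
  proof cases
    case ab
    show ?thesis
    proof (rule fixed_by_two[of a b c "a - 1" b c a "b - 1" c])
      fix x y z assume xyz: "config n x y z" "token_move x y z (a - 1) b c" "token_move x y z a (b - 1) c"
      then have "x = a \<and> y = b \<and> z = c \<or> x + y + z < a + b + c"
        using ab by (auto simp: move_simps)
      then show "x = a \<and> y = b \<and> z = c \<or> fixed x y z" using IH xyz(1) by blast
    qed (use ab abc in \<open>auto simp: move_simps intro!: IH\<close>)
  next
    case ac
    show ?thesis
    proof (rule fixed_by_two[of a b c "a - 1" b c a b "c - 1"])
      fix x y z assume xyz: "config n x y z" "token_move x y z (a - 1) b c" "token_move x y z a b (c - 1)"
      then have "x = a \<and> y = b \<and> z = c \<or> x + y + z < a + b + c"
        using ac by (auto simp: move_simps)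
      then show "x = a \<and> y = b \<and> z = c \<or> fixed x y z" using IH xyz(1) by blast
    qed (use ac abc in \<open>auto simp: move_simps intro!: IH\<close>)
  next
    case bc
    show ?thesis
    proof (rule fixed_by_two[of a b c a "b - 1" c a b "c - 1"])
      fix x y z assume xyz: "config n x y z" "token_move x y z a (b - 1) c" "token_move x y z a b (c - 1)"
      then have "x = a \<and> y = b \<and> z = c \<or> x + y + z < a + b + c"
        using bc by (auto simp: move_simps)
      then show "x = a \<and> y = b \<and> z = c \<or> fixed x y z" using IH xyz(1) by blast
    qed (use bc abc in \<open>auto simp: move_simps intro!: IH\<close>)
  qed
qed

text \<open>A configuration in which only one token can move down is recovered from the result of that
  move: all other neighbours of the result are fixed already, by the induction hypothesis or by
  the preceding lemma. The one exception is the pair 125, 134 above 124.\<close>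

lemma fixed_all:
  assumes "fixed 1 2 3" "4 \<le> n \<Longrightarrow> fixed 1 3 4" "config n a b c"
  shows "fixed a b c"
  using assms(3)
proof (induction "a + b + c" arbitrary: a b c rule: less_induct)
  case less
  note abc = less.prems
  have IH: "fixed x y z" if "config n x y z" "x + y + z < a + b + c" for x y z
    using less.hyps that by blast
  \<comment> \<open>The inequality is weak on purpose: \<open>fixed_step\<close> uses only strictly
    smaller sums, so it also covers competitors of the same sum as the current
    configuration.\<close>
  have step: "fixed x y z" if "config n x y z" "x + y + z \<le> a + b + c"
    "1 < x \<and> x + 1 < y \<or> 1 < x \<and> y + 1 < z \<or> x + 1 < y \<and> y + 1 < z" for x y z
    using fixed_step[OF that(1,3)] IH that(2) by simp
  \<comment> \<open>When at most one token can move down, the tokens below a gap are packed against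
    the left end, and the position of that gap gives the remaining shapes. \<open>{1, 3, 4}\<close>
    is split off as the exception.\<close>
  have "(1 < a \<and> a + 1 < b \<or> 1 < a \<and> b + 1 < c \<or> a + 1 < b \<and> b + 1 < c) \<or>
    a = 1 \<and> b = 2 \<and> c = 3 \<or> a = 1 \<and> b = 2 \<and> 3 < c \<or> a = 1 \<and> b = 3 \<and> c = 4 \<or>
    a = 1 \<and> 3 < b \<and> c = b + 1 \<or> 1 < a \<and> b = a + 1 \<and> c = a + 2"
    using abc unfolding config_def by presburger
  then consider (two) "1 < a \<and> a + 1 < b \<or> 1 < a \<and> b + 1 < c \<or> a + 1 < b \<and> b + 1 < c"
    | (bottom) "a = 1" "b = 2" "c = 3" | (c) "a = 1" "b = 2" "3 < c"
    | (134) "a = 1" "b = 3" "c = 4" | (bc) "a = 1" "3 < b" "c = b + 1"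
    | (abc) "1 < a" "b = a + 1" "c = a + 2"
    by meson
  then show ?case
  proof cases
    case two
    then show ?thesis using step abc by blast
  next
    case bottom
    then show ?thesis using assms(1) by simp
  next
    case c
    show ?thesis
    proof (rule fixed_by_one[of a b c 1 2 "c - 1"])
      fix x y z assume xyz: "config n x y z" "token_move x y z 1 2 (c - 1)"
      \<comment> \<open>The only competitor above \<open>{1, 2, c - 1}\<close> is
        \<open>{1, 3, c - 1}\<close>. It is \<open>{1, 3, 4}\<close> for \<open>c = 5\<close>, and
        for larger \<open>c\<close> its two upper tokens can both move down.\<close>
      then consider "x = a \<and> y = b \<and> z = c" | "x + y + z < a + b + c"
        | "x = 1" "y = 3" "z = 4" "4 \<le> n"
        | "x + y + z \<le> a + b + c" "x + 1 < y \<and> y + 1 < z"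
        using c by (simp add: move_simps) linarith
      then show "x = a \<and> y = b \<and> z = c \<or> fixed x y z"
        using IH step xyz(1) assms(2) by cases auto
    qed (use c abc in \<open>auto simp: move_simps intro!: IH\<close>)
  next
    case 134
    then show ?thesis using assms(2) abc by (simp add: config_def)
  next
    case bc
    show ?thesis
    proof (rule fixed_by_one[of a b c 1 "b - 1" c])
      fix x y z assume xyz: "config n x y z" "token_move x y z 1 (b - 1) c"
      \<comment> \<open>The competitors are \<open>{2, b - 1, c}\<close> and
        \<open>{1, b - 1, c + 1}\<close>. In the second the middle token can move down precisely
        because \<open>3 < b\<close>.\<close>
      then consider "x = a \<and> y = b \<and> z = c" | "x + y + z < a + b + c"
        | "x + y + z \<le> a + b + c" "1 < x \<and> y + 1 < z \<or> x + 1 < y \<and> y + 1 < z"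
        using bc by (simp add: move_simps) linarith
      then show "x = a \<and> y = b \<and> z = c \<or> fixed x y z"
        using IH step xyz(1) by cases auto
    qed (use bc abc in \<open>auto simp: move_simps intro!: IH\<close>)
  next
    case abc
    show ?thesis
    proof (rule fixed_by_one[of a b c "a - 1" b c])
      fix x y z assume xyz: "config n x y z" "token_move x y z (a - 1) b c"
      \<comment> \<open>The only competitor is \<open>{a - 1, b, c + 1}\<close>, with a gap below
        each of its two upper tokens.\<close>
      then consider "x = a \<and> y = b \<and> z = c" | "x + y + z < a + b + c"
        | "x + y + z \<le> a + b + c" "x + 1 < y \<and> y + 1 < z"
        using abc by (simp add: move_simps) linarith
      then show "x = a \<and> y = b \<and> z = c \<or> fixed x y z"
        using IH step xyz(1) by cases auto
    qed (use abc less.prems in \<open>auto simp: move_simps intro!: IH\<close>)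
  qed
qed

text \<open>This serves as a test for the identity: products of automorphisms are recognised by
  their values at these two vertices alone.\<close>

lemma eq_one:
  assumes "fixed 1 2 3" "4 \<le> n \<Longrightarrow> fixed 1 3 4"
  shows "f = \<one>\<^bsub>graph_aut_group (path_tokens n)\<^esub>"
proof (rule graph_automorphism_eqI[OF f])
  interpret group "graph_aut_group (path_tokens n)" by (rule group_graph_aut_group)
  show "\<one>\<^bsub>graph_aut_group (path_tokens n)\<^esub> \<in> graph_automorphisms (path_tokens n)"
    using one_closed carrier_graph_aut_group by metis
  fix A assume A: "A \<in> pverts (path_tokens n)"
  then obtain a b c where "config n a b c" "A = {a, b, c}" by (rule path_tokens_vertsE)
  then have "f A = A" using fixed_all assms by blast
  then show "f A = \<one>\<^bsub>graph_aut_group (path_tokens n)\<^esub> A"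
    using A by (simp add: one_graph_aut_group)
qed

text \<open>The two ends of the token graph are its only vertices of degree one.\<close>

lemma image_bottom:
  assumes n: "4 \<le> n"
  shows "fixed 1 2 3 \<or> f {1, 2, 3} = {n - 2, n - 1, n}"
proof -
  have b: "config n 1 2 3" using n by (simp add: config_def)
  obtain a b c where abc: "config n a b c" "f {1, 2, 3} = {a, b, c}" using image_config[OF b] .
  \<comment> \<open>Any neighbour of the image pulls back to a neighbour of
    \<open>{1, 2, 3}\<close>, which can only be \<open>{1, 2, 4}\<close>. Unequal sums merely ensure
    that the two given neighbours differ.\<close>
  have unique: False
    if xyz: "config n x y z" "token_move x y z a b c" and uvw: "config n u v w" "token_move u v w a b c"
      and ne: "x + y + z \<noteq> u + v + w" for x y z u v w
  proof -
    obtain x' y' z' where 1: "config n x' y' z'" "f {x', y', z'} = {x, y, z}" "token_move x' y' z' 1 2 3"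
      using preimage_move[OF b abc(2,1) xyz] .
    obtain u' v' w' where 2: "config n u' v' w'" "f {u', v', w'} = {u, v, w}" "token_move u' v' w' 1 2 3"
      using preimage_move[OF b abc(2,1) uvw] .
    have "x' = 1 \<and> y' = 2 \<and> z' = 4" "u' = 1 \<and> v' = 2 \<and> w' = 4"
      using 1 2 by (auto simp: move_simps)
    then have "{x, y, z} = {u, v, w}" using 1(2) 2(2) by simp
    from config_eq_iff[OF xyz(1) uvw(1), THEN iffD1, OF this] show False using ne by simp
  qed
  \<comment> \<open>Away from both ends some token can move down and some token can move up, which
    yields two neighbours of different sums.\<close>
  have down: "\<exists>x y z. config n x y z \<and> token_move x y z a b c \<and> x + y + z < a + b + c"
    if "\<not> (a = 1 \<and> b = 2 \<and> c = 3)"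
  proof -
    have "1 < a \<or> a + 1 < b \<or> b + 1 < c"
      using that abc(1) unfolding config_def by linarith
    then consider "1 < a" | "a + 1 < b" | "b + 1 < c" by blast
    then show ?thesis
    proof cases
      case 1 then show ?thesis using abc(1)
        by (intro exI[of _ "a - 1"] exI[of _ b] exI[of _ c]) (auto simp: move_simps)
    next
      case 2 then show ?thesis using abc(1)
        by (intro exI[of _ a] exI[of _ "b - 1"] exI[of _ c]) (auto simp: move_simps)
    next
      case 3 then show ?thesis using abc(1)
        by (intro exI[of _ a] exI[of _ b] exI[of _ "c - 1"]) (auto simp: move_simps)
    qed
  qed
  have up: "\<exists>x y z. config n x y z \<and> token_move x y z a b c \<and> a + b + c < x + y + z"
    if "\<not> (a = n - 2 \<and> b = n - 1 \<and> c = n)"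
  proof -
    have "c < n \<or> a + 1 < b \<or> b + 1 < c"
      using that abc(1) unfolding config_def by linarith
    then consider "c < n" | "a + 1 < b" | "b + 1 < c" by blast
    then show ?thesis
    proof cases
      case 1 then show ?thesis using abc(1)
        by (intro exI[of _ a] exI[of _ b] exI[of _ "c + 1"]) (auto simp: move_simps)
    next
      case 2 then show ?thesis using abc(1)
        by (intro exI[of _ "a + 1"] exI[of _ b] exI[of _ c]) (auto simp: move_simps)
    next
      case 3 then show ?thesis using abc(1)
        by (intro exI[of _ a] exI[of _ "b + 1"] exI[of _ c]) (auto simp: move_simps)
    qed
  qed
  show ?thesis
  proof (rule ccontr)
    assume "\<not> ?thesis"
    then have "\<not> (a = 1 \<and> b = 2 \<and> c = 3)" "\<not> (a = n - 2 \<and> b = n - 1 \<and> c = n)"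
      using abc(2) by metis+
    then obtain x y z u v w where "config n x y z" "token_move x y z a b c" "x + y + z < a + b + c"
      and "config n u v w" "token_move u v w a b c" "a + b + c < u + v + w"
      using down up by metis
    then show False using unique[of x y z u v w] by simp
  qed
qed

section \<open>Vertices close to the bottom end\<close>

text \<open>\<open>{1, 2, 4}\<close> is the only neighbour of \<open>{1, 2, 3}\<close>.\<close>

lemma fixed_124:
  assumes bot: "fixed 1 2 3" and n: "4 \<le> n"
  shows "fixed 1 2 4"
proof (rule image_move)
  show "config n 1 2 4" "config n 1 2 3" "config n 1 2 3" using n by (auto simp: config_def)
  show "token_move 1 2 4 1 2 3" by (simp add: move_simps)
  fix u v w assume "config n u v w" "f {1, 2, 4} = {u, v, w}" "token_move u v w 1 2 3"
  moreover have "u = 1 \<and> v = 2 \<and> w = 4" using calculation by (auto simp: move_simps)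
  ultimately show ?thesis by simp
qed (rule bot)

text \<open>The neighbours of the fixed vertex \<open>{1, 2, 4}\<close> are permuted. One of them,
  \<open>{1, 2, 3}\<close>, is fixed, so the others are fixed or swapped; for \<open>n = 4\<close>
  only \<open>{1, 3, 4}\<close> is left.\<close>

lemma image_134:
  assumes bot: "fixed 1 2 3" and n: "4 \<le> n"
  shows "fixed 1 3 4 \<or> 5 \<le> n \<and> f {1, 3, 4} = {1, 2, 5} \<and> f {1, 2, 5} = {1, 3, 4}"
proof -
  have c: "config n 1 2 3" "config n 1 2 4" "config n 1 3 4" using n by (auto simp: config_def)
  have m: "token_move 1 3 4 1 2 4" "token_move 1 2 5 1 2 4"
    by (auto simp: move_simps)
  note 124 = fixed_124[OF bot n]
  \<comment> \<open>Among the neighbours of \<open>{1, 2, 4}\<close>, the condition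
    \<open>c \<noteq> 3\<close> excludes just \<open>{1, 2, 3}\<close>.\<close>
  have nb: "f {a, b, c} = {1, 3, 4} \<or> 5 \<le> n \<and> f {a, b, c} = {1, 2, 5}"
    if abc: "config n a b c" "token_move a b c 1 2 4" "c \<noteq> 3" for a b c
  proof (rule image_move[OF abc(1) c(2) abc(2) 124 c(2)])
    fix u v w assume uvw: "config n u v w" "f {a, b, c} = {u, v, w}" "token_move u v w 1 2 4"
    have "f {a, b, c} \<noteq> {1, 2, 3}" using image_eq_iff[OF abc(1) c(1)] bot abc(3) by simp
    moreover have "u = 1 \<and> v = 2 \<and> w = 3 \<or> u = 1 \<and> v = 3 \<and> w = 4 \<or> u = 1 \<and> v = 2 \<and> w = 5 \<and> 5 \<le> n"
      using uvw(1,3) by (auto simp: move_simps)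
    ultimately show ?thesis using uvw(2) by auto
  qed
  show ?thesis
  proof (cases "5 \<le> n")
    case True
    then have c5: "config n 1 2 5" by (simp add: config_def)
    have "f {1, 3, 4} \<noteq> f {1, 2, 5}" using image_eq_iff[OF c(3) c5] by simp
    then show ?thesis using nb[OF c(3) m(1)] nb[OF c5 m(2)] by auto
  next
    case False
    then show ?thesis using nb[OF c(3) m(1)] by auto
  qed
qed

text \<open>A swap would force \<open>{2, 3, 4}\<close>, of degree two, onto
  \<open>{1, 2, 6}\<close>, which has degree three once \<open>7 \<le> n\<close>. For
  \<open>n = 5\<close> there is no \<open>{1, 2, 6}\<close> to receive it.\<close>

lemma fixed_134:
  assumes bot: "fixed 1 2 3" and n: "4 \<le> n" "n \<noteq> 6"
  shows "fixed 1 3 4"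
proof (rule ccontr)
  assume "\<not> fixed 1 3 4"
  then have n5: "5 \<le> n" and sw: "f {1, 3, 4} = {1, 2, 5}" "f {1, 2, 5} = {1, 3, 4}"
    using image_134[OF bot n(1)] by auto
  have c: "config n 1 2 3" "config n 1 2 4" "config n 1 3 4" "config n 1 2 5" "config n 1 3 5" "config n 2 3 4"
    using n5 by (auto simp: config_def)
  have m: "token_move 1 3 5 1 3 4" "token_move 2 3 4 1 3 4" "token_move 1 3 5 1 2 5"
    by (auto simp: move_simps)
  note 124 = fixed_124[OF bot n(1)]
  \<comment> \<open>The condition \<open>b \<noteq> 2\<close> excludes \<open>{1, 2, 4}\<close>; the
    other neighbours of \<open>{1, 3, 4}\<close> must go to the other neighbours of
    \<open>{1, 2, 5}\<close>.\<close>
  have nb: "f {a, b, c} = {1, 3, 5} \<or> 6 \<le> n \<and> f {a, b, c} = {1, 2, 6}"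
    if abc: "config n a b c" "token_move a b c 1 3 4" "b \<noteq> 2" for a b c
  proof (rule image_move[OF abc(1) c(3) abc(2) sw(1) c(4)])
    fix u v w assume uvw: "config n u v w" "f {a, b, c} = {u, v, w}" "token_move u v w 1 2 5"
    have "f {a, b, c} \<noteq> {1, 2, 4}" using image_eq_iff[OF abc(1) c(2)] 124 abc(3) by simp
    moreover have "u = 1 \<and> v = 2 \<and> w = 4 \<or> u = 1 \<and> v = 3 \<and> w = 5 \<or> u = 1 \<and> v = 2 \<and> w = 6 \<and> 6 \<le> n"
      using uvw(1,3) by (auto simp: move_simps)
    ultimately show ?thesis using uvw(2) by auto
  qed
  have ne: "f {2, 3, 4} \<noteq> f {1, 3, 5}" using image_eq_iff[OF c(6,5)] by simp
  \<comment> \<open>Below 6 both \<open>{2, 3, 4}\<close> and \<open>{1, 3, 5}\<close> would have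
    the single possible image \<open>{1, 3, 5}\<close>.\<close>
  have n7: "7 \<le> n"
  proof (rule ccontr)
    assume "\<not> 7 \<le> n"
    then have "\<not> 6 \<le> n" using n(2) by simp
    then have "f {2, 3, 4} = {1, 3, 5}" "f {1, 3, 5} = {1, 3, 5}"
      using nb[OF c(6) m(2)] nb[OF c(5) m(1)] by simp_all
    then show False using ne by (simp only:)
  qed
  \<comment> \<open>As a common neighbour of the swapped pair, \<open>{1, 3, 5}\<close> has an image
    adjacent to \<open>{1, 3, 4}\<close> too, and \<open>{1, 2, 6}\<close> is not.\<close>
  have "f {1, 3, 5} \<noteq> {1, 2, 6}"
  proof (rule image_move[OF c(5,4) m(3) sw(2) c(3)])
    fix u v w assume uvw: "config n u v w" "f {1, 3, 5} = {u, v, w}" "token_move u v w 1 3 4"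
    have c126: "config n 1 2 6" using n7 by (simp add: config_def)
    have "{u, v, w} \<noteq> {1, 2, 6}"
    proof
      assume "{u, v, w} = {1, 2, 6}"
      from config_eq_iff[OF uvw(1) c126, THEN iffD1, OF this] show False
        using uvw(3) by (simp add: move_simps)
    qed
    then show ?thesis using uvw(2) by simp
  qed
  then have "f {1, 3, 5} = {1, 3, 5}" using nb[OF c(5) m(1)] by simp
  then have 234: "f {2, 3, 4} = {1, 2, 6}" using nb[OF c(6) m(2)] ne by simp
  have c': "config n 1 2 6" "config n 1 3 6" "config n 1 2 7" "config n 2 3 5"
    using n7 by (auto simp: config_def)
  \<comment> \<open>The condition \<open>w \<noteq> 5\<close> excludes \<open>{1, 2, 5}\<close>, the
    image of \<open>{1, 3, 4}\<close>. Every other neighbour of \<open>{1, 2, 6}\<close> must come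
    from \<open>{2, 3, 5}\<close>, the only other neighbour of \<open>{2, 3, 4}\<close>.\<close>
  have pre: "f {2, 3, 5} = {u, v, w}"
    if uvw: "config n u v w" "token_move u v w 1 2 6" "w \<noteq> 5" for u v w
  proof (rule preimage_move[OF c(6) 234 c'(1) uvw(1,2)])
    fix a b c' assume abc: "config n a b c'" "f {a, b, c'} = {u, v, w}" "token_move a b c' 2 3 4"
    have "{a, b, c'} \<noteq> {1, 3, 4}"
    proof
      assume "{a, b, c'} = {1, 3, 4}"
      then have "{1, 2, 5} = {u, v, w}" using abc(2) sw(1) by (simp only:)
      from config_eq_iff[OF c(4) uvw(1), THEN iffD1, OF this] show False using uvw(3) by simp
    qed
    moreover have "a = 1 \<and> b = 3 \<and> c' = 4 \<or> a = 2 \<and> b = 3 \<and> c' = 5"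
      using abc(1,3) by (auto simp: move_simps)
    ultimately show ?thesis using abc(2) by auto
  qed
  have "{1, 3, 6} = {1, 2, 7 :: nat}"
    using pre[OF c'(2)] pre[OF c'(3)] by (simp add: move_simps)
  then show False using config_eq_iff[OF c'(2,3)] by simp
qed

end

section \<open>The symmetries\<close>

text \<open>The restriction makes the map extensional, as membership in \<open>Bij\<close>
  demands.\<close>

definition reflection :: "nat \<Rightarrow> nat set \<Rightarrow> nat set" where
  "reflection n = restrict (\<lambda>A. (\<lambda>x. n + 1 - x) ` A) (pverts (path_tokens n))"

definition complementation :: "nat set \<Rightarrow> nat set" where
  "complementation = restrict (\<lambda>A. {1..6} - A) (pverts (path_tokens 6))"

lemma reflection_config:
  "config n a b c \<Longrightarrow> reflection n {a, b, c} = {n + 1 - c, n + 1 - b, n + 1 - a}"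
  using config_verts[of n a b c] by (auto simp: reflection_def)

text \<open>Reflection reverses the order of the tokens, so a move of the lowest token becomes a
  move of the highest.\<close>

lemma reflection_aut: "reflection n \<in> graph_automorphisms (path_tokens n)"
  unfolding reflection_def
proof (rule graph_automorphism_involution)
  let ?h = "\<lambda>A. (\<lambda>x. n + 1 - x) ` A"
  have r: "config n (n + 1 - c) (n + 1 - b) (n + 1 - a)" if "config n a b c" for a b c
    using that by (auto simp: config_def)
  have h: "?h {a, b, c} = {n + 1 - c, n + 1 - b, n + 1 - a}" for a b c by auto
  show "?h A \<in> pverts (path_tokens n)" "?h (?h A) = A" if A: "A \<in> pverts (path_tokens n)" for A
  proof -
    obtain a b c where abc: "config n a b c" "A = {a, b, c}" using A by (rule path_tokens_vertsE)
    show "?h A \<in> pverts (path_tokens n)" unfolding abc(2) h by (rule config_verts[OF r[OF abc(1)]])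
    show "?h (?h A) = A" unfolding abc(2) h using abc(1) by (simp add: config_def)
  qed
  fix A B assume arc: "(A, B) \<in> parcs (path_tokens n)"
    and "A \<in> pverts (path_tokens n)" and B: "B \<in> pverts (path_tokens n)"
  from this(3) obtain x y z where B: "config n x y z" "B = {x, y, z}" by (rule path_tokens_vertsE)
  obtain a b c where A: "config n a b c" "A = {a, b, c}" "token_move a b c x y z"
    using path_tokens_nbrs[OF arc[unfolded B(2)] B(1)] .
  \<comment> \<open>The bounds guard against truncated subtraction.\<close>
  have near: "near (n + 1 - i) (n + 1 - j)" if "near i j" "i \<le> n" "j \<le> n" for i j
    using that unfolding near_def by linarith
  have "token_move (n + 1 - c) (n + 1 - b) (n + 1 - a) (n + 1 - z) (n + 1 - y) (n + 1 - x)"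
    using A(3) near[of a x] near[of b y] near[of c z] A(1) B(1)
    unfolding token_move_def config_def by (elim disjE conjE) simp_all
  then show "(?h A, ?h B) \<in> parcs (path_tokens n)"
    unfolding A(2) B(2) h using token_move_iff[OF r[OF A(1)] r[OF B(1)]] by simp
qed

text \<open>Complements within \<open>{1..6}\<close> have the same symmetric differences, hence the
  same arcs, and 6 - 3 = 3 preserves the number of tokens.\<close>

lemma complementation_aut: "complementation \<in> graph_automorphisms (path_tokens 6)"
  unfolding complementation_def
proof (rule graph_automorphism_involution)
  have V: "A \<in> pverts (path_tokens 6) \<longleftrightarrow> A \<subseteq> {1..6} \<and> card A = 3" for A
    by (auto simp: token_graph_def path_graph_def Let_def intro: finite_subset)
  show closed: "{1..6} - A \<in> pverts (path_tokens 6)" if "A \<in> pverts (path_tokens 6)" for A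
    using that card_Diff_subset[of A "{1..6}"] finite_subset[of A "{1..6}"] by (simp add: V)
  show "{1..6} - ({1..6} - A) = A" if "A \<in> pverts (path_tokens 6)" for A
    using that by (auto simp: V)
  fix A B assume arc: "(A, B) \<in> parcs (path_tokens 6)"
    and AB: "A \<in> pverts (path_tokens 6)" "B \<in> pverts (path_tokens 6)"
  have "sym_diff ({1..6} - A) ({1..6} - B) = sym_diff A B"
    using AB by (auto simp: V)
  then show "({1..6} - A, {1..6} - B) \<in> parcs (path_tokens 6)"
    using arc closed[OF AB(1)] closed[OF AB(2)] by (simp add: path_tokens_arc_iff)
qed

lemma complementation_config:
  "config 6 a b c \<Longrightarrow> complementation {a, b, c} = {1..6} - {a, b, c}"
  using config_verts[of 6 a b c] by (auto simp: complementation_def)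

section \<open>Determination of the automorphism group in the three cases\<close>

theorem theorem8:
  fixes n :: nat
  assumes "n \<ge> 3"
  shows "(n = 3 \<longrightarrow> graph_aut_group (token_graph 3 (path_graph n)) \<cong> integer_mod_group 1) \<and>
         (n = 6 \<longrightarrow> graph_aut_group (token_graph 3 (path_graph n)) \<cong>
                     integer_mod_group 2 \<times>\<times> integer_mod_group 2) \<and>
         (n \<noteq> 3 \<and> n \<noteq> 6 \<longrightarrow>
                     graph_aut_group (token_graph 3 (path_graph n)) \<cong> integer_mod_group 2)"
proof -
  let ?G = "graph_aut_group (path_tokens n)" and ?r = "reflection n"
  interpret group ?G by (rule group_graph_aut_group)
  have aut: "f \<in> carrier ?G \<longleftrightarrow> path_tokens_aut n f" for f
    by (simp add: carrier_graph_aut_group path_tokens_aut_def)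
  have cancel: "g = h"
    if "f \<otimes>\<^bsub>?G\<^esub> g = f \<otimes>\<^bsub>?G\<^esub> h" "f \<in> carrier ?G" "g \<in> carrier ?G" "h \<in> carrier ?G" for f g h
    using that by (simp add: Units_eq)
  have r: "?r \<in> carrier ?G"
    by (simp add: carrier_graph_aut_group reflection_aut)
  have mult: "(f \<otimes>\<^bsub>?G\<^esub> g) {a, b, c} = f (g {a, b, c})"
    if "f \<in> carrier ?G" "g \<in> carrier ?G" "config n a b c" for f g a b c
    using that config_verts[OF that(3)]
    by (simp add: carrier_graph_aut_group mult_graph_aut_group compose_eq)
  have one: "f = \<one>\<^bsub>?G\<^esub>"
    if "f \<in> carrier ?G" "f {1, 2, 3} = {1, 2, 3}" "4 \<le> n \<Longrightarrow> f {1, 3, 4} = {1, 3, 4}" for f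
    using path_tokens_aut.eq_one that aut by blast
  have bot: "config n 1 2 3" using assms by (simp add: config_def)
  have r_bot: "?r {1, 2, 3} = {n - 2, n - 1, n}" and r_top: "?r {n - 2, n - 1, n} = {1, 2, 3}"
  proof -
    have "n + 1 - 3 = n - 2" "n + 1 - 2 = n - 1" "n + 1 - 1 = n" by simp_all
    then show "?r {1, 2, 3} = {n - 2, n - 1, n}"
      using reflection_config[OF bot] by (simp only:)
    have "config n (n - 2) (n - 1) n" using assms by (auto simp: config_def)
    moreover have "n + 1 - n = 1" "n + 1 - (n - 1) = 2" "n + 1 - (n - 2) = 3" using assms by simp_all
    ultimately show "?r {n - 2, n - 1, n} = {1, 2, 3}"
      using reflection_config[of n "n - 2" "n - 1" n] by (simp only:)
  qed
  have rr: "?r \<otimes>\<^bsub>?G\<^esub> ?r = \<one>\<^bsub>?G\<^esub>"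
  proof (rule one)
    show "(?r \<otimes>\<^bsub>?G\<^esub> ?r) {1, 2, 3} = {1, 2, 3}"
      using mult[OF r r bot] r_bot r_top by simp
    show "(?r \<otimes>\<^bsub>?G\<^esub> ?r) {1, 3, 4} = {1, 3, 4}" if "4 \<le> n"
    proof -
      have "config n 1 3 4" "config n (n + 1 - 4) (n + 1 - 3) (n + 1 - 1)"
        using that by (auto simp: config_def)
      then show ?thesis using mult[OF r r] reflection_config that by simp
    qed
  qed (use r in simp)
  \<comment> \<open>The bound excludes \<open>n = 3\<close>, where the reflection is the identity on
    the single vertex.\<close>
  have r_ne: "?r \<noteq> \<one>\<^bsub>?G\<^esub>" if "4 \<le> n"
  proof
    assume "?r = \<one>\<^bsub>?G\<^esub>"
    then have "{1, 2, 3} = {n - 2, n - 1, n}"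
      using r_bot config_verts[OF bot] by (simp add: one_graph_aut_group)
    then have "n \<in> {1, 2, 3}" by blast
    then show False using that by auto
  qed
  \<comment> \<open>An automorphism exchanging the ends is brought back to one fixing the bottom by
    composing it with the reflection.\<close>
  have fix_bot: "f {1, 2, 3} = {1, 2, 3} \<or> (?r \<otimes>\<^bsub>?G\<^esub> f) {1, 2, 3} = {1, 2, 3}"
    if "f \<in> carrier ?G" "4 \<le> n" for f
    using path_tokens_aut.image_bottom[of n f] that aut mult[OF r that(1) bot] r_top by auto
  have three: "?G \<cong> integer_mod_group 1" if "n = 3"
  proof -
    have "f = \<one>\<^bsub>?G\<^esub>" if f: "f \<in> carrier ?G" for f
    proof (rule one[OF f])
      obtain a b c where "config n a b c" "f {1, 2, 3} = {a, b, c}"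
        using path_tokens_aut.image_config[of n f 1 2 3] f aut bot by blast
      moreover have "a = 1 \<and> b = 2 \<and> c = 3"
        using calculation(1) \<open>n = 3\<close> by (auto simp: config_def)
      ultimately show "f {1, 2, 3} = {1, 2, 3}" by simp
    qed (use \<open>n = 3\<close> in simp)
    then have c: "carrier ?G = {\<one>\<^bsub>?G\<^esub>}" using one_closed by blast
    have "(\<lambda>_. 0) \<in> iso ?G (integer_mod_group 1)"
      by (auto simp: iso_def hom_def bij_betw_def c carrier_integer_mod_group)
    then show ?thesis unfolding is_iso_def by blast
  qed
  have generic: "?G \<cong> integer_mod_group 2" if n: "4 \<le> n" "n \<noteq> 6"
  proof (rule iso_integer_mod_group_2)
    have 1: "f = \<one>\<^bsub>?G\<^esub>" if "f \<in> carrier ?G" "f {1, 2, 3} = {1, 2, 3}" for f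
      using one path_tokens_aut.fixed_134[of n f] that aut n by blast
    \<comment> \<open>If \<open>f\<close> moves the bottom, then \<open>?r \<otimes> f\<close> is
      the identity, which equals \<open>?r \<otimes> ?r\<close>; cancelling gives
      \<open>f = ?r\<close>.\<close>
    have "f = \<one>\<^bsub>?G\<^esub> \<or> f = ?r" if f: "f \<in> carrier ?G" for f
      using fix_bot[OF f n(1)] 1[OF f] 1[of "?r \<otimes>\<^bsub>?G\<^esub> f"] r rr f cancel[of ?r f ?r] m_closed by metis
    then show "carrier ?G = {\<one>\<^bsub>?G\<^esub>, ?r}" using r one_closed by blast
    show "?r \<noteq> \<one>\<^bsub>?G\<^esub>" using r_ne n by simp
  qed
  have six: "?G \<cong> integer_mod_group 2 \<times>\<times> integer_mod_group 2" if n: "n = 6"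
  proof -
    let ?k = complementation
    let ?d = "?r \<otimes>\<^bsub>?G\<^esub> ?k"
    have k: "?k \<in> carrier ?G"
      using n by (simp add: carrier_graph_aut_group complementation_aut)
    then have d: "?d \<in> carrier ?G" using r by simp
    have c: "config n 1 2 5" "config n 1 3 4" "config n 4 5 6" "config n 2 5 6" "config n 3 4 6"
      using n by (auto simp: config_def)
    have sets: "{1..6} - {1, 2, 3} = {4, 5, 6 :: nat}" "{1..6} - {1, 3, 4} = {2, 5, 6 :: nat}"
      "{1..6} - {1, 2, 5} = {3, 4, 6 :: nat}" "{1..6} - {4, 5, 6} = {1, 2, 3 :: nat}"
      "{1..6} - {2, 5, 6} = {1, 3, 4 :: nat}"
      by auto
    have kv: "?k {1, 2, 3} = {4, 5, 6}" "?k {1, 3, 4} = {2, 5, 6}" "?k {1, 2, 5} = {3, 4, 6}"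
      "?k {4, 5, 6} = {1, 2, 3}" "?k {2, 5, 6} = {1, 3, 4}"
      using bot c n complementation_config sets by simp_all
    have rv: "?r {1, 3, 4} = {3, 4, 6}" "?r {4, 5, 6} = {1, 2, 3}" "?r {2, 5, 6} = {1, 2, 5}"
      "?r {3, 4, 6} = {1, 3, 4}"
      using c n reflection_config by simp_all
    \<comment> \<open>Thus \<open>?d\<close> realises the exceptional swap while fixing the
      bottom.\<close>
    have dv: "?d {1, 2, 3} = {1, 2, 3}" "?d {1, 3, 4} = {1, 2, 5}" "?d {1, 2, 5} = {1, 3, 4}"
      using mult[OF r k] bot c kv rv by simp_all
    have kk: "?k \<otimes>\<^bsub>?G\<^esub> ?k = \<one>\<^bsub>?G\<^esub>" and dd: "?d \<otimes>\<^bsub>?G\<^esub> ?d = \<one>\<^bsub>?G\<^esub>"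
      by (rule one; use mult[OF k k] mult[OF d d] bot c kv dv k d in simp)+
    have bot_fixed: "g = \<one>\<^bsub>?G\<^esub> \<or> g = ?d" if g: "g \<in> carrier ?G" "g {1, 2, 3} = {1, 2, 3}" for g
    proof -
      consider "g {1, 3, 4} = {1, 3, 4}" | "g {1, 3, 4} = {1, 2, 5}"
        using path_tokens_aut.image_134[of n g] g aut n by auto
      then show ?thesis
      proof cases
        case 1
        then show ?thesis using one g by blast
      next
        case 2
        \<comment> \<open>Composition with \<open>?d\<close> undoes the swap, so both tests for the
          identity are passed.\<close>
        have "?d \<otimes>\<^bsub>?G\<^esub> g = \<one>\<^bsub>?G\<^esub>"
          by (rule one) (use mult[OF d g(1)] bot c dv 2 g d in simp_all)
        then show ?thesis using dd cancel[OF _ d g(1) d] by simp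
      qed
    qed
    have four: "f \<in> {\<one>\<^bsub>?G\<^esub>, ?r, ?k, ?d}" if f: "f \<in> carrier ?G" for f
    proof -
      have "f {1, 2, 3} = {1, 2, 3} \<or> (?r \<otimes>\<^bsub>?G\<^esub> f) {1, 2, 3} = {1, 2, 3}"
        using fix_bot[OF f] n by simp
      \<comment> \<open>Either \<open>f\<close> or \<open>?r \<otimes> f\<close> fixes the bottom
        and is \<open>\<one>\<close> or \<open>?d\<close>. Writing these as
        \<open>?r \<otimes> ?r\<close> and \<open>?r \<otimes> ?k\<close> in the second case,
        cancellation leaves \<open>?r\<close> or \<open>?k\<close>.\<close>
      then consider "f = \<one>\<^bsub>?G\<^esub>" | "f = ?d" | "?r \<otimes>\<^bsub>?G\<^esub> f = ?r \<otimes>\<^bsub>?G\<^esub> ?r" | "?r \<otimes>\<^bsub>?G\<^esub> f = ?d"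
        using bot_fixed[OF f] bot_fixed[of "?r \<otimes>\<^bsub>?G\<^esub> f"] f r rr m_closed by metis
      then show ?thesis
        using cancel[OF _ r f r] cancel[OF _ r f k] by cases (simp_all only: insertI1 insertI2)
    qed
    show ?thesis
    proof (rule iso_integer_mod_group_2_DirProd[OF _ rr _ kk])
      show "carrier ?G = {\<one>\<^bsub>?G\<^esub>, ?r, ?k, ?d}" using four r k d one_closed by blast
      show "?r \<noteq> \<one>\<^bsub>?G\<^esub>" using r_ne n by simp
      show "?k \<noteq> \<one>\<^bsub>?G\<^esub>"
      proof
        assume "?k = \<one>\<^bsub>?G\<^esub>"
        then have "\<one>\<^bsub>?G\<^esub> {1, 2, 3} = {4, 5, 6}" using kv(1) by (simp only:)
        then have "{1, 2, 3} = {4, 5, 6 :: nat}"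
          using config_verts[OF bot] by (simp add: one_graph_aut_group)
        then have "1 \<in> {4, 5, 6 :: nat}" by blast
        then show False by simp
      qed
      show "?r \<noteq> ?k"
      proof
        assume "?r = ?k"
        then have "{3, 4, 6} = {2, 5, 6 :: nat}" using rv(1) kv(2) by simp
        then have "3 \<in> {2, 5, 6 :: nat}" by blast
        then show False by simp
      qed
    qed
  qed
  show ?thesis using three six generic assms by auto
qed

end
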